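(* Let $T$ be a tree. Then $\mathrm{pthin}(T)=2$ if and only if the following three conditions hold simultaneously: (1) $T$ has a vertex of degree at least $3$; (2) every vertex of $T$ of degree at least $5$ has at most $4$ neighbors of degree greater than $1$; (3) there exists a simple path $C_0$ in $T$ such that (a) every vertex of $T$ of degree at least $4$ lies on $C_0$, and (b) for every vertex $v$ of degree exactly $3$ that does not lie on $C_0$, $v$ is adjacent to some vertex $w$ of $C_0$, and this $w$ has degree at most $3$. (All degrees are degrees in $T$.)
   Context: All graphs are finite, simple, undirected. For a graph $G=(V,E)$, a linear ordering $<$ of $V$ and a partition of $V$ into classes are called strongly consistent if for every triple $r<s<t$ of vertices with $rt\in E$: if $r$ and $s$ belong to the same class then $st\in E$, and if $s$ and $t$ belong to the same class then $rs\in E$. $G$ is proper $k$-thin if there is an ordering of $V$ and a partition of $V$ into $k$ classes that are strongly consistent. The proper thinness $\mathrm{pthin}(G)$ is the minimum $k$ such that $G$ is proper $k$-thin. (Graphs with proper thinness $1$ are exactly the proper interval graphs; among trees, exactly the paths.) *)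

theory Defs
  imports Main
begin

definition simple_graph :: "'a set \<Rightarrow> ('a \<Rightarrow> 'a \<Rightarrow> bool) \<Rightarrow> bool" where
  "simple_graph V E \<longleftrightarrow> finite V \<and>
     (\<forall>u v. E u v \<longrightarrow> u \<in> V \<and> v \<in> V) \<and>
     (\<forall>u v. E u v \<longrightarrow> E v u) \<and> (\<forall>v. \<not> E v v)"

definition degree :: "'a set \<Rightarrow> ('a \<Rightarrow> 'a \<Rightarrow> bool) \<Rightarrow> 'a \<Rightarrow> nat" where
  "degree V E v = card {w \<in> V. E v w}"

definition is_path :: "'a set \<Rightarrow> ('a \<Rightarrow> 'a \<Rightarrow> bool) \<Rightarrow> 'a list \<Rightarrow> bool" where
  "is_path V E xs \<longleftrightarrow> xs \<noteq> [] \<and> distinct xs \<and> set xs \<subseteq> V \<and>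
     (\<forall>i. Suc i < length xs \<longrightarrow> E (xs ! i) (xs ! Suc i))"

definition is_cycle :: "'a set \<Rightarrow> ('a \<Rightarrow> 'a \<Rightarrow> bool) \<Rightarrow> 'a list \<Rightarrow> bool" where
  "is_cycle V E xs \<longleftrightarrow> length xs \<ge> 3 \<and> is_path V E xs \<and> E (last xs) (hd xs)"

definition connected_graph :: "'a set \<Rightarrow> ('a \<Rightarrow> 'a \<Rightarrow> bool) \<Rightarrow> bool" where
  "connected_graph V E \<longleftrightarrow>
     (\<forall>u\<in>V. \<forall>v\<in>V. \<exists>xs. is_path V E xs \<and> hd xs = u \<and> last xs = v)"

definition is_tree :: "'a set \<Rightarrow> ('a \<Rightarrow> 'a \<Rightarrow> bool) \<Rightarrow> bool" where
  "is_tree V E \<longleftrightarrow> simple_graph V E \<and> V \<noteq> {} \<and> connected_graph V E \<and>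
     (\<nexists>xs. is_cycle V E xs)"

text \<open>Strong consistency of an ordering (given by an injective rank function ord on V)
  and a partition into classes (given by a class function cls).\<close>
definition strongly_consistent ::
  "'a set \<Rightarrow> ('a \<Rightarrow> 'a \<Rightarrow> bool) \<Rightarrow> ('a \<Rightarrow> nat) \<Rightarrow> ('a \<Rightarrow> nat) \<Rightarrow> bool" where
  "strongly_consistent V E ord cls \<longleftrightarrow>
     (\<forall>r\<in>V. \<forall>s\<in>V. \<forall>t\<in>V. ord r < ord s \<and> ord s < ord t \<and> E r t \<longrightarrow>
        (cls r = cls s \<longrightarrow> E s t) \<and> (cls s = cls t \<longrightarrow> E r s))"

text \<open>Proper k-thin: some linear ordering of V and partition of V into (at most) k classes
  are strongly consistent.  (Allowing empty classes does not change the minimum.)\<close>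
definition proper_k_thin :: "'a set \<Rightarrow> ('a \<Rightarrow> 'a \<Rightarrow> bool) \<Rightarrow> nat \<Rightarrow> bool" where
  "proper_k_thin V E k \<longleftrightarrow>
     (\<exists>ord cls. inj_on ord V \<and> (\<forall>v\<in>V. cls v < k) \<and> strongly_consistent V E ord cls)"

definition pthin :: "'a set \<Rightarrow> ('a \<Rightarrow> 'a \<Rightarrow> bool) \<Rightarrow> nat" where
  "pthin V E = (LEAST k. proper_k_thin V E k)"

end

(* With two strongly consistent classes, edges inside a class join consecutive vertices of the
   class, and two edges between the classes never cross (crossing edges would close a 4-cycle). The
   tree path C0 from the first to the last vertex of one class therefore meets every edge between
   the classes, so a vertex off C0 has at most two neighbours of its own class and one on C0.

   Conversely, let C0 be a longest path as in (3), and take C0 and its complement as the classes.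
   Deleting the edges of C0 leaves one component for each of its vertices. Setting aside the pendant
   vertices (leaves attached to vertices of C0 of degree at least 4, and vertices of C0 of degree 3
   with a branch) turns every component into a path, by (2) and maximality. Maximality matters: it
   forces both C0-neighbours of a vertex to be nonleaves whenever the vertex has a nonleaf neighbour
   off C0. *)
theory Submission
  imports Defs "HOL-Library.Product_Lexorder"
begin

section \<open>Preliminaries: chains, walks and longest paths\<close>

lemma is_path_iff_successively:
  "is_path V E xs \<longleftrightarrow> xs \<noteq> [] \<and> distinct xs \<and> set xs \<subseteq> V \<and> successively E xs"
  unfolding is_path_def successively_conv_nth by auto

lemma in_set_drop_conv_nth:
  "x \<in> set (drop n xs) \<longleftrightarrow> (\<exists>j. n \<le> j \<and> j < length xs \<and> x = xs ! j)"
proof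
  assume "x \<in> set (drop n xs)"
  then obtain i where "i < length xs - n" "x = xs ! (n + i)" by (auto simp: in_set_conv_nth)
  then show "\<exists>j. n \<le> j \<and> j < length xs \<and> x = xs ! j" by (intro exI[of _ "n + i"]) auto
next
  assume "\<exists>j. n \<le> j \<and> j < length xs \<and> x = xs ! j"
  then obtain j where "n \<le> j" "j < length xs" "x = xs ! j" by blast
  then show "x \<in> set (drop n xs)" unfolding in_set_conv_nth by (intro exI[of _ "j - n"]) auto
qed

lemma card_le_2I:
  fixes f :: "'a \<Rightarrow> int"
  assumes "inj_on f S"
    and no3: "\<And>x y z. x \<in> S \<Longrightarrow> y \<in> S \<Longrightarrow> z \<in> S \<Longrightarrow> f x < f y \<Longrightarrow> f y < f z \<Longrightarrow> False"
  shows "card S \<le> 2"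
proof (rule ccontr)
  assume "\<not> card S \<le> 2"
  then obtain T where T: "T \<subseteq> S" "card T = 3"
    using obtain_subset_with_card_n[of 3 S] by auto
  then obtain x y z where xyz: "T = {x, y, z}" "x \<noteq> y" "y \<noteq> z" "x \<noteq> z"
    by (auto simp: card_3_iff)
  then have "f x \<noteq> f y" "f y \<noteq> f z" "f x \<noteq> f z"
    using T(1) assms(1) by (auto simp: inj_on_def)
  moreover have "x \<in> S" "y \<in> S" "z \<in> S" using xyz T by auto
  ultimately show False
    by (metis linorder_neqE no3)
qed

lemma successively_rtranclp:
  assumes "successively P xs" "symp P" "x \<in> set xs" "y \<in> set xs"
  shows "P\<^sup>*\<^sup>* x y"
proof -
  have hd: "P\<^sup>*\<^sup>* (hd xs) z" if "z \<in> set xs" "successively P xs" for z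
    using that
  proof (induction xs)
    case (Cons a xs)
    then show ?case
      by (cases xs) (auto intro: converse_rtranclp_into_rtranclp)
  qed simp
  have "symp P\<^sup>*\<^sup>*" using assms(2) by (rule symp_rtranclp)
  then show ?thesis
    using hd[OF assms(3,1)] hd[OF assms(4,1)] by (meson rtranclp_trans sympD)
qed

lemma rtranclp_obtain_path:
  assumes "P\<^sup>*\<^sup>* x y"
  obtains xs where "xs \<noteq> []" "hd xs = x" "last xs = y" "distinct xs" "successively P xs"
    "set xs \<subseteq> {z. P\<^sup>*\<^sup>* x z}"
proof -
  have "\<exists>xs. xs \<noteq> [] \<and> hd xs = x \<and> last xs = y \<and> distinct xs \<and> successively P xs \<and>
    set xs \<subseteq> {z. P\<^sup>*\<^sup>* x z}"
    using assms
  proof (induction rule: rtranclp_induct)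
    case base
    then show ?case by (intro exI[of _ "[x]"]) auto
  next
    case (step y z)
    then obtain xs where xs: "xs \<noteq> []" "hd xs = x" "last xs = y" "distinct xs" "successively P xs"
      "set xs \<subseteq> {z. P\<^sup>*\<^sup>* x z}" by blast
    show ?case
    proof (cases "z \<in> set xs")
      case True
      then obtain ys zs where "xs = ys @ z # zs" by (auto simp: in_set_conv_decomp)
      then show ?thesis using xs
        by (intro exI[of _ "ys @ [z]"]) (auto simp: successively_append_iff hd_append)
    next
      case False
      then show ?thesis using xs step.hyps
        by (intro exI[of _ "xs @ [z]"]) (auto simp: successively_append_iff)
    qed
  qed
  then show thesis using that by blast
qed

text \<open>Formulated for an arbitrary property of paths because it is needed both for paths inside
  a vertex set and for paths satisfying condition (3). Lengths are bounded because paths are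
  distinct lists over \<open>V\<close>.\<close>

lemma longest_path:
  assumes "finite V" "P ys" "\<And>xs. P xs \<Longrightarrow> is_path V E xs"
  obtains xs where "P xs" "\<And>ys. P ys \<Longrightarrow> length ys \<le> length xs"
proof -
  have "length xs < Suc (card V)" if "P xs" for xs
    using assms(3)[OF that] card_mono[OF assms(1), of "set xs"]
    by (auto simp: is_path_iff_successively distinct_card)
  then show thesis
    using ex_has_greatest_nat[of P ys length "Suc (card V)"] assms(2) that by auto
qed

section \<open>Trees: short cycles, bridges and vertices of low degree\<close>

locale tree =
  fixes V :: "'a set" and E :: "'a \<Rightarrow> 'a \<Rightarrow> bool"
  assumes tree: "is_tree V E"
begin

lemma finite_V: "finite V" and edge_V: "E x y \<Longrightarrow> x \<in> V \<and> y \<in> V"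
  and sym: "E x y \<Longrightarrow> E y x" and irrefl: "\<not> E x x" and V_nonempty: "V \<noteq> {}"
  and no_cycle: "\<not> is_cycle V E xs"
  using tree unfolding is_tree_def simple_graph_def by blast+

lemma edge_commute: "E x y \<longleftrightarrow> E y x"
  using sym by blast

lemma no_triangle: "E x y \<Longrightarrow> E y z \<Longrightarrow> E z x \<Longrightarrow> False"
  using no_cycle[of "[x, y, z]"] irrefl edge_V
  by (auto simp: is_cycle_def is_path_iff_successively)

lemma no_4_cycle: "E a b \<Longrightarrow> E b c \<Longrightarrow> E c d \<Longrightarrow> E d a \<Longrightarrow> a \<noteq> c \<Longrightarrow> b \<noteq> d \<Longrightarrow> False"
  using no_cycle[of "[a, b, c, d]"] irrefl edge_V
  by (auto simp: is_cycle_def is_path_iff_successively)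

text \<open>A walk between \<open>u\<close> and \<open>v\<close> that uses this edge in neither
  direction shortens to a simple path; the path has at least three vertices, so the edge closes it
  to a cycle.\<close>

lemma bridge:
  assumes "E u v"
  shows "\<not> (\<lambda>x y. E x y \<and> {x, y} \<noteq> {u, v})\<^sup>*\<^sup>* u v" (is "\<not> ?S\<^sup>*\<^sup>* u v")
proof
  assume "?S\<^sup>*\<^sup>* u v"
  then obtain xs where xs: "xs \<noteq> []" "hd xs = u" "last xs = v" "distinct xs" "successively ?S xs"
    by (rule rtranclp_obtain_path)
  have "u \<noteq> v" using assms irrefl by blast
  then obtain y ys where ys: "xs = u # y # ys"
    using xs(1-3) by (cases xs; cases "tl xs") auto
  moreover have "ys \<noteq> []" using xs ys by auto
  moreover have E: "successively E xs" using xs(5) by (rule successively_mono) auto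
  moreover have "set xs \<subseteq> V"
  proof
    fix z assume "z \<in> set xs"
    then have "E\<^sup>*\<^sup>* u z" using successively_rtranclp[OF E, of u z] sym ys by (auto intro: sympI)
    then show "z \<in> V" by (cases rule: rtranclp.cases) (use assms edge_V in auto)
  qed
  ultimately have "is_cycle V E xs"
    using xs assms sym by (cases ys) (auto simp: is_cycle_def is_path_iff_successively)
  then show False using no_cycle by blast
qed

text \<open>With two neighbours on the path, going from \<open>v\<close> to \<open>b'\<close> and
  then along the path to \<open>b\<close> would avoid the edge between \<open>v\<close> and
  \<open>b\<close>, which is a bridge.\<close>

lemma outside_path_unique_neighbour:
  assumes "is_path V E xs" "v \<notin> set xs" "b \<in> set xs" "b' \<in> set xs" "E v b" "E v b'"
  shows "b = b'"
proof (rule ccontr)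
  assume "b \<noteq> b'"
  let ?S = "\<lambda>x y. E x y \<and> {x, y} \<noteq> {v, b}"
  have "successively E xs" using assms(1) by (simp add: is_path_iff_successively)
  then have "successively ?S xs"
    by (rule successively_mono) (use assms(2) in \<open>auto simp: doubleton_eq_iff\<close>)
  moreover have "symp ?S" by (auto intro!: sympI sym)
  ultimately have "?S\<^sup>*\<^sup>* b' b" using assms(4,3) by (rule successively_rtranclp)
  moreover have "?S v b'" using \<open>b \<noteq> b'\<close> assms by (auto simp: doubleton_eq_iff)
  ultimately have "?S\<^sup>*\<^sup>* v b" by (rule converse_rtranclp_into_rtranclp[rotated])
  then show False using bridge[OF assms(5)] by blast
qed

text \<open>The first vertex of a longest path inside \<open>U\<close> will do: by maximality its
  neighbours in \<open>U\<close> lie on the path, and the rest of the path contains only one of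
  them.\<close>

lemma exists_low_degree:
  assumes "U \<subseteq> V" "U \<noteq> {}"
  shows "\<exists>x\<in>U. card {y \<in> U. E x y} \<le> 1"
proof -
  let ?P = "\<lambda>xs. is_path V E xs \<and> set xs \<subseteq> U"
  obtain u where "u \<in> U" using assms by blast
  then have "?P [u]" using assms by (auto simp: is_path_iff_successively)
  then obtain xs where xs: "?P xs" and longest: "\<And>ys. ?P ys \<Longrightarrow> length ys \<le> length xs"
    by (rule longest_path[OF finite_V, where P = ?P]) auto
  then obtain x ys where x: "xs = x # ys" by (cases xs) (auto simp: is_path_iff_successively)
  have "y = hd ys" "ys \<noteq> []" if "y \<in> U" "E x y" for y
  proof -
    have "y \<in> set xs"
    proof (rule ccontr)
      assume "y \<notin> set xs"
      then have "?P (y # xs)"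
        using xs that x assms sym by (auto simp: is_path_iff_successively)
      then show False using longest by fastforce
    qed
    then have y: "y \<in> set ys" using that irrefl x by auto
    then show "ys \<noteq> []" by auto
    have "is_path V E ys" using xs x y by (cases ys) (auto simp: is_path_iff_successively)
    moreover have "E x (hd ys)" "x \<notin> set ys" using xs x y by (cases ys; auto simp: is_path_iff_successively)+
    ultimately show "y = hd ys"
      using outside_path_unique_neighbour[of ys x y "hd ys"] y that by (metis hd_in_set \<open>ys \<noteq> []\<close>)
  qed
  then have "{y \<in> U. E x y} \<subseteq> {hd ys}" by auto
  then have "card {y \<in> U. E x y} \<le> 1" using card_mono[of "{hd ys}"] by fastforce
  then show ?thesis using xs x by auto
qed

end

section \<open>Vertex orderings of linear forests\<close>

text \<open>The hypotheses describe a linear forest; acyclicity enters as a vertex of degree at most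
  1 in every nonempty subset. Such a vertex \<open>x\<close> is removed, the rest is ordered, and
  \<open>x\<close> is put back beside its neighbour, on the side away from that neighbour's other
  neighbour.\<close>

lemma linear_forest_ordering:
  fixes Q :: "'a \<Rightarrow> 'a \<Rightarrow> bool"
  assumes "finite W" and sym: "symp Q" and irrefl: "\<And>x. \<not> Q x x"
    and "\<And>U. U \<subseteq> W \<Longrightarrow> U \<noteq> {} \<Longrightarrow> \<exists>x\<in>U. card {y \<in> U. Q x y} \<le> 1"
    and "\<And>x. x \<in> W \<Longrightarrow> card {y \<in> W. Q x y} \<le> 2"
  shows "\<exists>f :: 'a \<Rightarrow> int. inj_on f W \<and>
    (\<forall>r\<in>W. \<forall>s\<in>W. \<forall>t\<in>W. f r < f s \<longrightarrow> f s < f t \<longrightarrow> \<not> Q r t)"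
  using assms(1,4,5)
proof (induction W rule: finite_psubset_induct)
  case (psubset W)
  show ?case
  proof (cases "W = {}")
    case False
    then obtain x where x: "x \<in> W" "card {y \<in> W. Q x y} \<le> 1"
      using psubset.prems(1)[of W] by blast
    let ?W = "W - {x}"
    have "\<exists>f :: 'a \<Rightarrow> int. inj_on f ?W \<and>
      (\<forall>r\<in>?W. \<forall>s\<in>?W. \<forall>t\<in>?W. f r < f s \<longrightarrow> f s < f t \<longrightarrow> \<not> Q r t)"
    proof (rule psubset.IH)
      show "?W \<subset> W" using x by auto
      show "\<exists>x\<in>U. card {y \<in> U. Q x y} \<le> 1" if "U \<subseteq> ?W" "U \<noteq> {}" for U
        using psubset.prems(1) that by blast
      show "card {y \<in> ?W. Q z y} \<le> 2" if "z \<in> ?W" for z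
      proof -
        have "card {y \<in> ?W. Q z y} \<le> card {y \<in> W. Q z y}"
          by (rule card_mono) (use psubset.hyps in auto)
        then show ?thesis using psubset.prems(2)[of z] that by auto
      qed
    qed
    then obtain f :: "'a \<Rightarrow> int" where inj: "inj_on f ?W"
      and f: "\<And>r s t. r \<in> ?W \<Longrightarrow> s \<in> ?W \<Longrightarrow> t \<in> ?W \<Longrightarrow> f r < f s \<Longrightarrow> f s < f t \<Longrightarrow> \<not> Q r t"
      by blast
    \<comment> \<open>Doubling the old positions frees the odd numbers: \<open>2 * m + e\<close> is
      a place for \<open>x\<close> directly beside position \<open>m\<close>, and \<open>e\<close>
      chooses the side.\<close>
    have ex: "\<exists>m e::int. \<bar>e\<bar> = 1 \<and> (\<forall>r\<in>?W. \<forall>t\<in>?W. 2 * f r < 2 * m + e \<longrightarrow> 2 * m + e < 2 * f t \<longrightarrow> \<not> Q r t) \<and>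
      (\<forall>u\<in>?W. Q x u \<longrightarrow> f u = m)"
    proof (cases "\<exists>u\<in>?W. Q x u")
      case False
      \<comment> \<open>Without neighbours \<open>x\<close> goes to the right end; the inserted 0
        covers an empty \<open>?W\<close>.\<close>
      define m where "m = Max (insert 0 (f ` ?W))"
      have "f t \<le> m" if "t \<in> ?W" for t
        unfolding m_def using that psubset.hyps by auto
      then show ?thesis using False
        by (intro exI[of _ m] exI[of _ 1]) fastforce
    next
      case True
      then obtain u where u: "u \<in> ?W" "Q x u" by blast
      have unique: "v = u" if "v \<in> ?W" "Q x v" for v
        using x(2) u that psubset.hyps card_le_Suc0_iff_eq[of "{y \<in> W. Q x y}"] by auto
      have Qux: "Q u x" using u sym by (auto dest: sympD)
      have one: "v = w" if "v \<in> ?W" "w \<in> ?W" "Q u v" "Q u w" for v w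
      proof (rule ccontr)
        assume "v \<noteq> w"
        then have "card {x, v, w} = 3" using that by auto
        moreover have "card {x, v, w} \<le> card {y \<in> W. Q u y}"
          by (rule card_mono) (use psubset.hyps that x Qux in auto)
        ultimately show False using psubset.prems(2)[of u] u by auto
      qed
      \<comment> \<open>The vertex \<open>u\<close> has at most one neighbour besides
        \<open>x\<close>, and \<open>e\<close> points away from it.\<close>
      obtain e :: int where e: "\<bar>e\<bar> = 1"
        "\<And>v. v \<in> ?W \<Longrightarrow> Q u v \<Longrightarrow> (e = 1 \<and> f v < f u) \<or> (e = -1 \<and> f u < f v)"
      proof (cases "\<exists>v\<in>?W. Q u v \<and> f v < f u")
        case True
        then show thesis using that[of 1] one by auto
      next
        case F: False
        have "f u < f v" if "v \<in> ?W" "Q u v" for v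
          using F that inj u irrefl by (metis inj_onD linorder_neqE)
        then show thesis using that[of "-1"] by auto
      qed
      \<comment> \<open>An edge spanning the new place either spans \<open>u\<close>, which
        \<open>f\<close> excludes, or ends at \<open>u\<close>, which the choice of \<open>e\<close>
        excludes.\<close>
      have "\<not> Q r t" if rt: "r \<in> ?W" "t \<in> ?W" "2 * f r < 2 * f u + e" "2 * f u + e < 2 * f t" for r t
      proof
        assume Q: "Q r t"
        have "f r \<le> f u" "f u \<le> f t" using rt e(1) by linarith+
        then have "r = u \<or> t = u"
          using f[of r u t] inj u rt Q by (metis inj_onD order_less_le)
        then show False
        proof
          assume "r = u"
          then show False using e(2)[of t] Q rt by auto
        next
          assume "t = u"
          then show False using e(2)[of r] Q rt sym by (auto dest: sympD)
        qed
      qed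
      then show ?thesis using e(1) unique by (intro exI[of _ "f u"] exI[of _ e]) blast
    qed
    then obtain m e :: int where e: "\<bar>e\<bar> = 1"
      and between: "\<And>r t. r \<in> ?W \<Longrightarrow> t \<in> ?W \<Longrightarrow> 2 * f r < 2 * m + e \<Longrightarrow> 2 * m + e < 2 * f t \<Longrightarrow> \<not> Q r t"
      and nb: "\<And>u. u \<in> ?W \<Longrightarrow> Q x u \<Longrightarrow> f u = m"
      by blast
    define g where "g = (\<lambda>y. if y = x then 2 * m + e else 2 * f y)"
    have ne: "2 * m + e \<noteq> 2 * f y" for y using e by presburger
    have "inj_on g W"
    proof (rule inj_onI)
      fix y z assume yz: "y \<in> W" "z \<in> W" "g y = g z"
      then show "y = z" 
        using ne[of y] ne[of z] inj by (auto simp: g_def inj_on_def split: if_splits)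
    qed
    moreover have "\<not> Q r t" if W: "r \<in> W" "s \<in> W" "t \<in> W" and lt: "g r < g s" "g s < g t" for r s t
    proof
      assume Q: "Q r t"
      then have Q': "Q t r" using sym by (auto dest: sympD)
      consider "r = x" | "s = x" | "t = x" | "r \<noteq> x" "s \<noteq> x" "t \<noteq> x" by blast
      then show False
      proof cases
        case 1
        then have "s \<noteq> x" "t \<noteq> x" using lt by auto
        then show False using nb[of t] Q 1 lt W e by (auto simp: g_def)
      next
        case 2
        then have "r \<noteq> x" "t \<noteq> x" using lt by auto
        then show False using between[of r t] Q 2 lt W by (auto simp: g_def)
      next
        case 3
        then have "s \<noteq> x" "r \<noteq> x" using lt by auto
        then show False using nb[of r] Q' 3 lt W e by (auto simp: g_def)
      next
        case 4
        then show False using f[of r s t] lt W Q by (auto simp: g_def)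
      qed
    qed
    ultimately show ?thesis by blast
  qed auto
qed


section \<open>Necessity: two strongly consistent classes on a tree\<close>

locale consistent_tree = tree +
  fixes ord :: "'a \<Rightarrow> int" and cls :: "'a \<Rightarrow> nat"
  assumes inj: "inj_on ord V"
    and two_classes: "v \<in> V \<Longrightarrow> cls v < 2"
    and left_class: "E r t \<Longrightarrow> s \<in> V \<Longrightarrow> ord r < ord s \<Longrightarrow> ord s < ord t \<Longrightarrow> cls r = cls s \<Longrightarrow> E s t"
    and right_class: "E r t \<Longrightarrow> s \<in> V \<Longrightarrow> ord r < ord s \<Longrightarrow> ord s < ord t \<Longrightarrow> cls s = cls t \<Longrightarrow> E r s"
begin

lemma ord_cases:
  assumes "x \<in> V" "y \<in> V" "x \<noteq> y"
  obtains "ord x < ord y" | "ord y < ord x"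
  using assms inj by (metis inj_onD linorder_neqE)

text \<open>Each half of strong consistency joins \<open>z\<close> to one end of the edge, which
  closes a triangle.\<close>

lemma same_class_edge_consecutive:
  assumes "E x y" "cls x = cls y" "z \<in> V" "cls z = cls x" "ord x < ord z" "ord z < ord y"
  shows False
  using assms left_class[of x y z] right_class[of x y z] no_triangle[of x y z] sym by metis

text \<open>Here \<open>b\<close> may lie in either class. Its position decides which edge spans
  \<open>z\<close>: the one to \<open>y\<close> if \<open>b\<close> precedes \<open>z\<close>, the
  one to \<open>x\<close> otherwise.\<close>

lemma neighbourhood_convex:
  assumes "E b x" "E b y" "z \<in> V" "z \<noteq> b" "ord x < ord z" "ord z < ord y"
    "cls x = cls z" "cls z = cls y"
  shows "E b z"
proof -
  have "b \<in> V" using assms edge_V by blast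
  then consider "ord b < ord z" | "ord z < ord b" using assms ord_cases by metis
  then show ?thesis
    by cases (use assms left_class[of x b z] right_class[of b y z] edge_commute in auto)
qed

text \<open>However the two classes interleave, strong consistency joins the earlier ends
  \<open>a'\<close> and \<open>b'\<close> and also the later ends \<open>a\<close> and
  \<open>b\<close>; together with the given edges this is a 4-cycle.\<close>

lemma cross_edges_noncrossing:
  assumes "E a' b" "E a b'" "cls a = cls a'" "cls b = cls b'" "cls a \<noteq> cls b"
    "ord a' < ord a" "ord b' < ord b"
  shows False
proof -
  have V: "a \<in> V" "a' \<in> V" "b \<in> V" "b' \<in> V" using assms edge_V by blast+
  have ne: "a' \<noteq> b'" "a \<noteq> b" using assms by auto
  have "E a' b'"
    using ord_cases[OF V(2,4) ne(1)]
      right_class[of a' b b'] right_class[of b' a a'] assms V sym by metis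
  moreover have "E a b"
    using ord_cases[OF V(1,3) ne(2)]
      left_class[of a' b a] left_class[of b' a b] assms V sym by metis
  ultimately show False
    using no_4_cycle[of a' b a b'] assms edge_commute by auto
qed

text \<open>If \<open>v\<close> preceded \<open>x\<close>, the edge from \<open>v\<close> to
  \<open>y\<close> would skip over \<open>x\<close> in its own class; the other side is symmetric.
  Hence a vertex has at most one neighbour of its class on each side.\<close>

lemma same_class_neighbours:
  assumes "E v x" "E v y" "cls x = cls v" "cls y = cls v" "ord x < ord y"
  shows "ord x < ord v \<and> ord v < ord y"
proof -
  have V: "v \<in> V" "x \<in> V" "y \<in> V" "v \<noteq> x" "v \<noteq> y" using assms edge_V irrefl by blast+
  have "\<not> ord v < ord x" "\<not> ord y < ord v"
    using same_class_edge_consecutive[of v y x] same_class_edge_consecutive[of x v y] assms V edge_commute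
    by auto
  then show ?thesis using V ord_cases by metis
qed

lemma card_same_class_neighbours: "card {w \<in> V. E v w \<and> cls w = cls v} \<le> 2"
proof (rule card_le_2I)
  show "inj_on ord {w \<in> V. E v w \<and> cls w = cls v}"
    using inj by (rule inj_on_subset) auto
next
  fix x y z
  assume "x \<in> {w \<in> V. E v w \<and> cls w = cls v}" "y \<in> {w \<in> V. E v w \<and> cls w = cls v}"
    "z \<in> {w \<in> V. E v w \<and> cls w = cls v}" "ord x < ord y" "ord y < ord z"
  then show False using same_class_neighbours[of v x y] same_class_neighbours[of v y z] by auto
qed

lemma same_class_if_neq: "a \<in> V \<Longrightarrow> b \<in> V \<Longrightarrow> c \<in> V \<Longrightarrow> cls a \<noteq> cls c \<Longrightarrow> cls b \<noteq> cls c \<Longrightarrow> cls a = cls b"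
  using two_classes[of a] two_classes[of b] two_classes[of c] by linarith

text \<open>Suppose \<open>b2\<close> has a further neighbour \<open>z\<close>. In the class of
  \<open>a\<close>, its edge to \<open>b2\<close> would cross the edge from \<open>a\<close> to
  \<open>b1\<close> or to \<open>b3\<close>. In the class of \<open>b2\<close>, either that edge
  skips over \<open>b1\<close> or \<open>b3\<close>, or \<open>z\<close> lies between them and
  convexity makes it adjacent to \<open>a\<close>, closing a triangle.\<close>

lemma inner_cross_neighbour_is_leaf:
  assumes "E a b1" "E a b2" "E a b3" "ord b1 < ord b2" "ord b2 < ord b3"
    "cls b1 \<noteq> cls a" "cls b2 \<noteq> cls a" "cls b3 \<noteq> cls a" "E b2 z"
  shows "z = a"
proof (rule ccontr)
  assume ne: "z \<noteq> a"
  have V: "a \<in> V" "b1 \<in> V" "b2 \<in> V" "b3 \<in> V" "z \<in> V" using assms edge_V by blast+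
  have b: "cls b1 = cls b2" "cls b2 = cls b3"
    using same_class_if_neq[of b1 b2 a] same_class_if_neq[of b2 b3 a] V assms by auto
  show False
  proof (cases "cls z = cls a")
    case True
    moreover have "E z b2" using assms sym by blast
    ultimately have "\<not> ord z < ord a" "\<not> ord a < ord z"
      using cross_edges_noncrossing[of z b2 a b1] cross_edges_noncrossing[of a b3 z b2] assms b
      by auto
    then show False using ord_cases[OF V(5,1) ne] by blast
  next
    case False
    then have z: "cls z = cls b2" using same_class_if_neq[of z b2 a] V assms by auto
    have noz: "\<not> E a z" using no_triangle[of a b2 z] assms sym by blast
    then have "z \<noteq> b1" "z \<noteq> b3" "z \<noteq> b2" using assms irrefl by auto
    then have "ord z \<noteq> ord b1" "ord z \<noteq> ord b2" "ord z \<noteq> ord b3"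
      using V inj by (auto dest: inj_onD)
    then consider "ord z < ord b1" | "ord b1 < ord z" "ord z < ord b2" | "ord b2 < ord z" "ord z < ord b3"
      | "ord b3 < ord z"
      by linarith
    then show False
    proof cases
      case 1
      then show False using same_class_edge_consecutive[of z b2 b1] assms b z V edge_commute by auto
    next
      case 2
      then show False using neighbourhood_convex[of a b1 b2 z] noz ne assms b z V by auto
    next
      case 3
      then show False using neighbourhood_convex[of a b2 b3 z] noz ne assms b z V by auto
    next
      case 4
      show False
        by (rule same_class_edge_consecutive[OF assms(9) _ V(4)])
          (use 4 b z assms(5) in simp_all)
    qed
  qed
qed

text \<open>This gives condition (2): at most two neighbours share the class of \<open>a\<close>,
  and among those of the other class only the first and the last can be nonleaves.\<close>

lemma card_nonleaf_neighbours:
  assumes "a \<in> V"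
  shows "card {w \<in> V. E a w \<and> degree V E w > 1} \<le> 4"
proof -
  let ?A = "{w \<in> V. E a w \<and> cls w = cls a}"
  let ?B = "{w \<in> V. E a w \<and> cls w \<noteq> cls a \<and> degree V E w > 1}"
  have "card ?B \<le> 2"
  proof (rule card_le_2I)
    show "inj_on ord ?B" using inj by (rule inj_on_subset) auto
  next
    fix x y z
    assume *: "x \<in> ?B" "y \<in> ?B" "z \<in> ?B" "ord x < ord y" "ord y < ord z"
    then have "{w \<in> V. E y w} \<subseteq> {a}" using inner_cross_neighbour_is_leaf[of a x y z] by auto
    then have "degree V E y \<le> 1"
      unfolding degree_def using card_mono[of "{a}"] by fastforce
    then show False using * by auto
  qed
  moreover have "card {w \<in> V. E a w \<and> degree V E w > 1} \<le> card (?A \<union> ?B)"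
    by (rule card_mono) (use finite_V in auto)
  ultimately show ?thesis
    using card_same_class_neighbours[of a] card_Un_le[of ?A ?B] by linarith
qed

text \<open>The ends of a cross edge separate the vertices before them from those after them.\<close>

lemma path_meets_cross_edge:
  assumes "E a b" "cls a \<noteq> cls b" "successively E xs" "xs \<noteq> []" "set xs \<subseteq> V"
    "cls (hd xs) = cls a" "cls (last xs) = cls a" "ord (hd xs) \<le> ord a" "ord a \<le> ord (last xs)"
  shows "a \<in> set xs \<or> b \<in> set xs"
proof (rule ccontr)
  assume avoid: "\<not> (a \<in> set xs \<or> b \<in> set xs)"
  have V: "a \<in> V" "b \<in> V" using assms edge_V by blast+
  \<comment> \<open>\<open>?L\<close> collects the vertices that precede the end of the cross edge
    lying in their own class. An edge leaving \<open>?L\<close> without touching \<open>a\<close> or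
    \<open>b\<close> would skip over one of them inside a class or cross the edge between
    them.\<close>
  let ?L = "\<lambda>z. z \<in> V \<and> (cls z = cls a \<and> ord z < ord a \<or> cls z = cls b \<and> ord z < ord b)"
  have step: "?L z'" if L: "?L z" and E: "E z z'" and ne: "z' \<noteq> a" "z' \<noteq> b" for z z'
  proof (rule ccontr)
    assume nL: "\<not> ?L z'"
    have V': "z' \<in> V" using E edge_V by blast
    have "ord z' \<noteq> ord a" "ord z' \<noteq> ord b" using V V' ne inj by (auto dest: inj_onD)
    moreover have "cls z' = cls a \<or> cls z' = cls b"
      using same_class_if_neq[of z' b a] V V' assms(2) by auto
    ultimately have R: "cls z' = cls a \<and> ord a < ord z' \<or> cls z' = cls b \<and> ord b < ord z'"
      using nL V' by linarith
    have rev: "E b a" "E z' z" using E assms(1) sym by blast+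
    have "cls z = cls a \<and> ord z < ord a \<or> cls z = cls b \<and> ord z < ord b"
      using L by (rule conjunct2)
    then consider (aa) "cls z = cls a" "ord z < ord a" "cls z' = cls a" "ord a < ord z'"
      | (ab) "cls z = cls a" "ord z < ord a" "cls z' = cls b" "ord b < ord z'"
      | (ba) "cls z = cls b" "ord z < ord b" "cls z' = cls a" "ord a < ord z'"
      | (bb) "cls z = cls b" "ord z < ord b" "cls z' = cls b" "ord b < ord z'"
      using R by argo
    then show False
    proof cases
      case aa
      show False by (rule same_class_edge_consecutive[OF E _ V(1)]) (simp_all add: aa)
    next
      case ab
      show False by (rule cross_edges_noncrossing[OF E assms(1)]) (simp_all add: ab assms(2))
    next
      case ba
      show False
        by (rule cross_edges_noncrossing[OF assms(1) rev(2)]) (simp_all add: ba assms(2))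
    next
      case bb
      show False by (rule same_class_edge_consecutive[OF E _ V(2)]) (simp_all add: bb)
    qed
  qed
  have "?L (last xs)" if "?L (hd xs)"
    using assms(3,4) avoid that
  proof (induction xs)
    case (Cons x xs)
    show ?case
    proof (cases "xs = []")
      case False
      then have "?L (hd xs)" using step[of x "hd xs"] Cons.prems
        by (cases xs) auto
      then show ?thesis using Cons False by (auto simp: successively_Cons)
    qed (use Cons.prems in auto)
  qed simp
  moreover have "?L (hd xs)"
  proof -
    have "hd xs \<in> set xs" using assms by auto
    then have "hd xs \<in> V" "hd xs \<noteq> a" using assms avoid by auto
    moreover from this have "ord (hd xs) \<noteq> ord a" using V inj by (auto dest: inj_onD)
    ultimately show ?thesis using assms(6,8) by auto
  qed
  ultimately show False using assms by auto
qed

lemma exists_spine: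
  "\<exists>C0. is_path V E C0 \<and>
     (\<forall>v\<in>V. degree V E v \<ge> 4 \<longrightarrow> v \<in> set C0) \<and>
     (\<forall>v\<in>V. degree V E v = 3 \<and> v \<notin> set C0 \<longrightarrow>
        (\<exists>w\<in>set C0. E v w \<and> degree V E w \<le> 3))"
proof -
  obtain v0 where v0: "v0 \<in> V" using V_nonempty by blast
  let ?A = "{v \<in> V. cls v = cls v0}"
  have fin: "finite ?A" "?A \<noteq> {}" using finite_V v0 by auto
  obtain x where x: "x \<in> ?A" "\<And>a. a \<in> ?A \<Longrightarrow> ord x \<le> ord a"
    using arg_min_if_finite[OF fin, of ord] that[of "arg_min_on ord ?A"] by force
  obtain y where y: "y \<in> ?A" "\<And>a. a \<in> ?A \<Longrightarrow> ord a \<le> ord y"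
    using arg_min_if_finite[OF fin, of "\<lambda>v. - ord v"] that[of "arg_min_on (\<lambda>v. - ord v) ?A"]
    by force
  obtain C where C: "is_path V E C" "hd C = x" "last C = y"
    using tree x y unfolding is_tree_def connected_graph_def by blast
  \<comment> \<open>One end of the edge lies in the class of \<open>v0\<close>. As \<open>C\<close>
    runs from the first to the last vertex of that class, \<open>path_meets_cross_edge\<close>
    applies from that end.\<close>
  have hit: "a \<in> set C \<or> b \<in> set C" if "E a b" "cls a \<noteq> cls b" for a b
  proof -
    have V: "a \<in> V" "b \<in> V" using that edge_V by blast+
    then have "cls a = cls v0 \<or> cls b = cls v0" using same_class_if_neq[of a v0 b] v0 that by metis
    then show ?thesis
      using path_meets_cross_edge[of a b C] path_meets_cross_edge[of b a C] that C x y V edge_commute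
      by (auto simp: is_path_iff_successively)
  qed
  have main: "degree V E v = 3 \<and> (\<exists>w\<in>set C. E v w \<and> degree V E w \<le> 3)"
    if v: "v \<in> V" "v \<notin> set C" "degree V E v \<ge> 3" for v
  proof -
    let ?S = "\<lambda>v. {w \<in> V. E v w \<and> cls w = cls v}" and ?O = "\<lambda>v. {w \<in> V. E v w \<and> cls w \<noteq> cls v}"
    have split: "degree V E v = card (?S v) + card (?O v)" for v
    proof -
      have "{w \<in> V. E v w} = ?S v \<union> ?O v" by blast
      moreover have "card (?S v \<union> ?O v) = card (?S v) + card (?O v)"
        by (rule card_Un_disjoint) (use finite_V in auto)
      ultimately show ?thesis unfolding degree_def by simp
    qed
    \<comment> \<open>By \<open>hit\<close>, every neighbour of \<open>v\<close> in the other class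
      lies on \<open>C\<close>, and a vertex off a path has at most one neighbour on it.\<close>
    have O: "card (?O v) \<le> 1"
    proof -
      have "b = b'" if "b \<in> ?O v" "b' \<in> ?O v" for b b'
        using outside_path_unique_neighbour[OF C(1) v(2), of b b'] that hit[of v b] hit[of v b'] v(2)
        by auto
      then show ?thesis using finite_V by (auto simp: card_le_Suc0_iff_eq)
    qed
    have S: "card (?S v) \<le> 2" for v by (rule card_same_class_neighbours)
    have cards: "card (?S v) = 2" "card (?O v) = 1"
      using split[of v] O S[of v] v(3) by linarith+
    obtain b where b: "b \<in> ?O v" using cards(2) by (metis card_1_singletonE insertI1)
    then have bC: "b \<in> set C" using hit[of v b] v(2) by auto
    obtain p q where pq: "p \<in> ?S v" "q \<in> ?S v" "p \<noteq> q"
      using cards(1) by (auto simp: card_2_iff)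
    then have "ord p < ord q \<or> ord q < ord p" using ord_cases[of p q] by blast
    then obtain p q where p: "p \<in> ?S v" and q: "q \<in> ?S v" and "ord p < ord q"
      using pq by blast
    then have ord: "ord p < ord v" "ord v < ord q" using same_class_neighbours[of v p q] by auto
    \<comment> \<open>The vertices \<open>p\<close>, \<open>v\<close>, \<open>q\<close> are
      consecutive in their class. Another neighbour \<open>a\<close> of \<open>b\<close> in that
      class lies inside one of the two edges at \<open>v\<close>, or beyond \<open>p\<close> or
      \<open>q\<close>; then convexity makes \<open>p\<close> or \<open>q\<close> adjacent to
      \<open>b\<close>, closing a triangle with \<open>v\<close>.\<close>
    have "?O b \<subseteq> {v}"
    proof
      fix a assume a: "a \<in> ?O b"
      then have cls: "cls a = cls v" using b same_class_if_neq[of a v b] v by auto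
      have nb: "p \<noteq> b" "q \<noteq> b" using b p q by auto
      have no: "\<not> E b p" "\<not> E b q" using no_triangle[of v b] b p q sym by blast+
      show "a \<in> {v}"
      proof (rule ccontr)
        assume "a \<notin> {v}"
        moreover have "a \<noteq> p" "a \<noteq> q" using a no by auto
        ultimately have "ord a \<noteq> ord p" "ord a \<noteq> ord q" "ord a \<noteq> ord v"
          using a p q v(1) inj by (auto dest: inj_onD)
        then consider "ord a < ord p" | "ord p < ord a" "ord a < ord v"
          | "ord v < ord a" "ord a < ord q" | "ord q < ord a"
          by linarith
        then show False
        proof cases
          case 1
          then show False
            using neighbourhood_convex[of b a v p] a b p ord cls no nb edge_commute by auto
        next
          case 2
          then show False
            using same_class_edge_consecutive[of p v a] a p cls edge_commute by auto
        next
          case 3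
          then show False
            using same_class_edge_consecutive[of v q a] a q cls edge_commute by auto
        next
          case 4
          then show False
            using neighbourhood_convex[of b v a q] a b q ord cls no nb edge_commute by auto
        qed
      qed
    qed
    then have "card (?O b) \<le> 1" using card_mono[of "{v}"] by fastforce
    then have "degree V E b \<le> 3" using split[of b] S[of b] by linarith
    then show ?thesis using split[of v] cards b bC by auto
  qed
  show ?thesis using main C(1) by (intro exI[of _ C]) fastforce
qed

end

section \<open>Sufficiency: rank functions and longest spines\<close>

text \<open>Lets orderings be built with keys in any linear order, such as integers or lexicographic
  triples, although strong consistency asks for natural numbers.\<close>

lemma exists_nat_rank:
  fixes key :: "'a \<Rightarrow> 'b :: linorder"
  assumes "finite V" "inj_on key V"
  obtains ord :: "'a \<Rightarrow> nat"
  where "inj_on ord V" "\<And>x y. x \<in> V \<Longrightarrow> y \<in> V \<Longrightarrow> ord x < ord y \<Longrightarrow> key x < key y"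
proof -
  let ?ord = "\<lambda>x. card {z \<in> V. key z < key x}"
  have mono: "?ord x < ?ord y" if "x \<in> V" "key x < key y" for x y
    by (rule psubset_card_mono) (use assms(1) that in auto)
  show thesis
  proof (rule that[of ?ord])
    show "inj_on ?ord V"
    proof (rule inj_onI)
      fix x y assume xy: "x \<in> V" "y \<in> V" "?ord x = ?ord y"
      then have "\<not> key x < key y" "\<not> key y < key x" using mono[of x y] mono[of y x] by auto
      then have "key x = key y" by simp
      then show "x = y" using assms(2) xy by (auto dest: inj_onD)
    qed
  next
    fix x y assume xy: "x \<in> V" "y \<in> V" "?ord x < ?ord y"
    show "key x < key y"
    proof (rule ccontr)
      assume "\<not> key x < key y"
      then have "?ord y \<le> ?ord x" by (intro card_mono) (use assms(1) in auto)
      then show False using xy by simp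
    qed
  qed
qed

context tree
begin

definition spine :: "'a list \<Rightarrow> bool" where
  "spine C \<longleftrightarrow> is_path V E C \<and>
     (\<forall>v\<in>V. degree V E v \<ge> 4 \<longrightarrow> v \<in> set C) \<and>
     (\<forall>v\<in>V. degree V E v = 3 \<and> v \<notin> set C \<longrightarrow>
        (\<exists>w\<in>set C. E v w \<and> degree V E w \<le> 3))"

lemma is_path_rev: "is_path V E (rev xs) \<longleftrightarrow> is_path V E xs"
  by (simp add: is_path_iff_successively edge_commute)

lemma spine_rev: "spine (rev xs) \<longleftrightarrow> spine xs"
  by (simp add: spine_def is_path_rev)

lemma path_forward_edge:
  assumes "is_path V E (xs @ a # b # ys)" "c \<in> set (b # ys)" "E a c"
  shows "c = b"
  using assms by (intro outside_path_unique_neighbour[of "b # ys" a])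
    (auto simp: is_path_iff_successively successively_append_iff)

lemma path_edge_consecutive:
  assumes "is_path V E C" "i < j" "j < length C" "E (C ! i) (C ! j)"
  shows "j = Suc i"
proof -
  let ?x = "C ! Suc i"
  have C: "C = take i C @ C ! i # ?x # drop (Suc (Suc i)) C"
    using assms by (simp add: Cons_nth_drop_Suc)
  have "C ! j \<in> set (?x # drop (Suc (Suc i)) C)"
  proof -
    have "?x # drop (Suc (Suc i)) C = drop (Suc i) C" using assms by (simp add: Cons_nth_drop_Suc)
    then show ?thesis using assms in_set_drop_conv_nth[of "C ! j" "Suc i" C] by (metis Suc_leI)
  qed
  then have "C ! j = ?x" using path_forward_edge[of "take i C" "C ! i" ?x "drop (Suc (Suc i)) C" "C ! j"] assms C by simp
  then show ?thesis using assms by (auto simp: is_path_iff_successively nth_eq_iff_index_eq)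
qed

text \<open>A walk without spine edges from \<open>C ! i\<close> to \<open>C ! j\<close>, continued
  back along the path to \<open>C ! Suc i\<close>, would bypass the edge between
  \<open>C ! i\<close> and \<open>C ! Suc i\<close>, which is a bridge.\<close>

lemma path_vertices_separated:
  assumes "is_path V E C" "i < j" "j < length C"
  shows "\<not> (\<lambda>x y. E x y \<and> \<not> (x \<in> set C \<and> y \<in> set C))\<^sup>*\<^sup>* (C ! i) (C ! j)"
    (is "\<not> ?R\<^sup>*\<^sup>* _ _")
proof
  assume R: "?R\<^sup>*\<^sup>* (C ! i) (C ! j)"
  let ?S = "\<lambda>x y. E x y \<and> {x, y} \<noteq> {C ! i, C ! Suc i}"
  have C: "distinct C" "successively E C" using assms by (auto simp: is_path_iff_successively)
  have "?S\<^sup>*\<^sup>* (C ! i) (C ! j)"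
  proof (rule rtranclp_mono[THEN predicate2D, OF _ R])
    have "C ! i \<in> set C" "C ! Suc i \<in> set C" using assms by auto
    then show "?R \<le> ?S" by (auto simp: doubleton_eq_iff)
  qed
  moreover have "?S\<^sup>*\<^sup>* (C ! j) (C ! Suc i)"
  proof (rule successively_rtranclp[of _ "drop (Suc i) C"])
    have "successively E (drop (Suc i) C)"
      using C(2) by (metis append_take_drop_id successively_append_iff)
    then show "successively ?S (drop (Suc i) C)"
    proof (rule successively_mono)
      fix x y assume xy: "x \<in> set (drop (Suc i) C)" "y \<in> set (drop (Suc i) C)" "E x y"
      have "C ! i \<notin> set (drop (Suc i) C)"
        using C(1) assms by (auto simp: in_set_drop_conv_nth nth_eq_iff_index_eq)
      then show "?S x y" using xy by (auto simp: doubleton_eq_iff)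
    qed
    show "symp ?S" by (auto intro!: sympI sym simp: insert_commute)
    show "C ! j \<in> set (drop (Suc i) C)" using assms by (auto simp: in_set_drop_conv_nth intro!: exI[of _ j])
    show "C ! Suc i \<in> set (drop (Suc i) C)" using assms by (auto simp: in_set_drop_conv_nth intro!: exI[of _ "Suc i"])
  qed
  ultimately have "?S\<^sup>*\<^sup>* (C ! i) (C ! Suc i)" by (rule rtranclp_trans)
  moreover have "E (C ! i) (C ! Suc i)" using assms by (auto simp: is_path_def)
  ultimately show False using bridge by blast
qed

definition longest_spine :: "'a list \<Rightarrow> bool" where
  "longest_spine C \<longleftrightarrow> spine C \<and> (\<forall>ys. spine ys \<longrightarrow> length ys \<le> length C)"

lemma longest_spine_rev: "longest_spine (rev xs) \<longleftrightarrow> longest_spine xs"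
  by (simp add: longest_spine_def spine_rev)

text \<open>Prepending \<open>x\<close> would give a longer path, and condition (3) survives the
  extension.\<close>

lemma longest_spine_hd:
  assumes "longest_spine C" "E (hd C) x"
  shows "x \<in> set C"
proof (rule ccontr)
  assume x: "x \<notin> set C"
  have "spine C" using assms by (simp add: longest_spine_def)
  then have "spine (x # C)"
    using x assms(2) edge_V sym unfolding spine_def
    by (auto simp: is_path_iff_successively successively_Cons)
  then show False using assms(1) by (fastforce simp: longest_spine_def)
qed

text \<open>If \<open>p\<close> were the only vertex before \<open>c\<close>, it would be a leaf by
  maximality, and replacing it by \<open>y\<close>, \<open>x\<close> would give a longer spine. The
  vertex \<open>q\<close> shows that \<open>p\<close> is not a leaf.\<close>

lemma longest_spine_before_nonleaf:
  assumes longest: "longest_spine (ys @ c # zs)"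
    and x: "E c x" "x \<notin> set (ys @ c # zs)" and y: "E x y" "y \<noteq> c"
  obtains ws q p where "ys = ws @ [q, p]"
proof (cases ys rule: rev_cases)
  case Nil
  then show thesis using longest_spine_hd[OF longest, of x] x by simp
next
  case ys: (snoc us p)
  show thesis
  proof (cases us rule: rev_cases)
    case (snoc ws q)
    then show thesis using that ys by simp
  next
    case Nil
    let ?C = "p # c # zs"
    have C: "longest_spine ?C" using longest ys Nil by simp
    then have spine: "spine ?C" and path: "is_path V E ?C" by (auto simp: longest_spine_def spine_def)
    have x': "x \<notin> set ?C" using x ys Nil by auto
    have y': "y \<notin> set ?C"
      using outside_path_unique_neighbour[OF path x', of y c] x y sym by auto
    have p: "w = c" if "E p w" for w
    proof -
      have "w \<in> set ?C" using longest_spine_hd[OF C] that by simp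
      then show ?thesis using path_forward_edge[of "[]" p c zs w] path that irrefl by auto
    qed
    have deg: "degree V E p \<le> 1"
    proof -
      have "{w \<in> V. E p w} \<subseteq> {c}" using p by auto
      then show ?thesis unfolding degree_def using card_mono[of "{c}"] by fastforce
    qed
    have "is_path V E (y # x # c # zs)"
      using path x x' y y' edge_V sym irrefl by (auto simp: is_path_iff_successively)
    moreover have "v \<in> set (y # x # c # zs)" if "v \<in> V" "degree V E v \<ge> 4" for v
      using spine that deg unfolding spine_def by fastforce
    moreover have "\<exists>w\<in>set (y # x # c # zs). E v w \<and> degree V E w \<le> 3"
      if v: "v \<in> V" "degree V E v = 3" "v \<notin> set (y # x # c # zs)" for v
    proof -
      have "v \<noteq> p" using deg v by auto
      then obtain w where w: "w \<in> set ?C" "E v w" "degree V E w \<le> 3"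
        using spine v unfolding spine_def by auto
      \<comment> \<open>Dropping \<open>p\<close> loses no witness for (b), since the only neighbour
        of \<open>p\<close> is \<open>c\<close>.\<close>
      then have "w \<noteq> p" using p[of v] sym v by auto
      then show ?thesis using w by auto
    qed
    ultimately have "spine (y # x # c # zs)" by (simp add: spine_def)
    then have "length (y # x # c # zs) \<le> length ?C" using C unfolding longest_spine_def by blast
    then show thesis by simp
  qed
qed

end

section \<open>Sufficiency: the two classes built from a longest spine\<close>

locale longest_spine_tree = tree +
  fixes C :: "'a list"
  assumes longest: "longest_spine C"
    and branching: "v \<in> V \<Longrightarrow> degree V E v \<ge> 5 \<Longrightarrow> card {w \<in> V. E v w \<and> degree V E w > 1} \<le> 4"
begin

lemma path: "is_path V E C" and distinct: "distinct C" and C_subset: "set C \<subseteq> V"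
  and heavy: "v \<in> V \<Longrightarrow> degree V E v \<ge> 4 \<Longrightarrow> v \<in> set C"
  and degree_3: "v \<in> V \<Longrightarrow> degree V E v = 3 \<Longrightarrow> v \<notin> set C \<Longrightarrow> \<exists>w\<in>set C. E v w \<and> degree V E w \<le> 3"
  using longest by (auto simp: longest_spine_def spine_def is_path_iff_successively)

lemma spine_neighbour_unique:
  "v \<notin> set C \<Longrightarrow> b \<in> set C \<Longrightarrow> b' \<in> set C \<Longrightarrow> E v b \<Longrightarrow> E v b' \<Longrightarrow> b = b'"
  using outside_path_unique_neighbour[OF path] by blast

text \<open>By maximality \<open>c\<close> is not an end of the spine, so two of its neighbours lie
  on it. In particular a spine vertex of degree 3 has at most one branch.\<close>

lemma card_off_spine_neighbours:
  assumes "c \<in> set C" "E c x" "x \<notin> set C"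
  shows "card {w \<in> V. E c w \<and> w \<notin> set C} + 2 \<le> degree V E c"
proof -
  obtain ys zs where C: "C = ys @ c # zs" using assms(1) by (auto simp: in_set_conv_decomp)
  have "ys \<noteq> []" using longest_spine_hd[OF longest, of x] C assms by auto
  then obtain ys' p where p: "ys = ys' @ [p]" by (cases ys rule: rev_cases) auto
  have "zs \<noteq> []" using longest_spine_hd[of "rev C" x] longest longest_spine_rev[of C] C assms
    by (intro notI) simp
  then obtain s zs' where s: "zs = s # zs'" by (cases zs) auto
  have ps: "p \<noteq> s" "E c p" "E c s" "p \<in> set C" "s \<in> set C" using path C p s sym
    by (auto simp: is_path_iff_successively successively_append_iff)
  have "card ({w \<in> V. E c w \<and> w \<notin> set C} \<union> {p, s}) = card {w \<in> V. E c w \<and> w \<notin> set C} + card {p, s}"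
    by (rule card_Un_disjoint) (use finite_V ps in auto)
  moreover have "card ({w \<in> V. E c w \<and> w \<notin> set C} \<union> {p, s}) \<le> degree V E c"
    unfolding degree_def by (rule card_mono) (use finite_V ps C_subset in auto)
  ultimately show ?thesis using ps by simp
qed

text \<open>One nonleaf off the spine already makes both spine neighbours of \<open>c\<close>
  nonleaves, by the exchange argument applied to \<open>C\<close> and its reverse. Three of them
  would give \<open>c\<close> five nonleaf neighbours, against condition (2).\<close>

lemma card_off_spine_nonleaves:
  assumes "c \<in> set C"
  shows "card {w \<in> V. E c w \<and> w \<notin> set C \<and> degree V E w > 1} \<le> 2" (is "card ?N \<le> 2")
proof (rule ccontr)
  assume big: "\<not> card ?N \<le> 2"
  have fin: "finite ?N" using finite_V by auto
  have "?N \<noteq> {}" using big by (metis card.empty zero_le)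
  then obtain x where x: "x \<in> ?N" by blast
  obtain y where y: "E x y" "y \<noteq> c"
  proof -
    have "\<not> {w \<in> V. E x w} \<subseteq> {c}"
      using x card_mono[of "{c}" "{w \<in> V. E x w}"] by (auto simp: degree_def)
    then show thesis using that by auto
  qed
  obtain ys zs where C: "C = ys @ c # zs" using assms(1) by (auto simp: in_set_conv_decomp)
  obtain ws q p where p: "ys = ws @ [q, p]"
    using longest_spine_before_nonleaf[of ys c zs x y] longest C x y by auto
  have "longest_spine (rev zs @ c # rev ys)" using longest longest_spine_rev[of C] C by simp
  then obtain ws' t s where "rev zs = ws' @ [t, s]"
    using longest_spine_before_nonleaf[of "rev zs" c "rev ys" x y] C x y by auto
  then have s: "zs = s # t # rev ws'" by (simp add: rev_eq_append_conv)
  have E: "p \<noteq> s" "E c p" "E c s" "E p q" "E s t" "p \<in> set C" "s \<in> set C" "q \<noteq> c" "t \<noteq> c"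
    using path C p s sym by (auto simp: is_path_iff_successively successively_append_iff)
  have nonleaf: "degree V E v > 1" if "E v a" "E v b" "a \<noteq> b" for v a b
  proof -
    have "card {a, b} \<le> degree V E v"
      unfolding degree_def by (rule card_mono) (use that finite_V edge_V in auto)
    then show ?thesis using that by simp
  qed
  have "degree V E p > 1" "degree V E s > 1"
    using nonleaf[of p q c] nonleaf[of s t c] E sym by auto
  then have "card (?N \<union> {p, s}) \<le> card {w \<in> V. E c w \<and> degree V E w > 1}"
    by (intro card_mono) (use E finite_V C_subset in auto)
  moreover have "card (?N \<union> {p, s}) = card ?N + card {p, s}"
    by (rule card_Un_disjoint) (use finite_V E in auto)
  ultimately have "card {w \<in> V. E c w \<and> degree V E w > 1} \<ge> 5" using big E by simp
  moreover have "card {w \<in> V. E c w \<and> degree V E w > 1} \<le> degree V E c"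
    unfolding degree_def by (rule card_mono) (use finite_V in auto)
  ultimately show False using branching[of c] assms C_subset by auto
qed

text \<open>The tree with the edges of the spine deleted: a path in a tree has no chords, so an edge
  with both ends on \<open>C\<close> is an edge of \<open>C\<close>.\<close>

definition R :: "'a \<Rightarrow> 'a \<Rightarrow> bool" where
  "R x y \<longleftrightarrow> E x y \<and> \<not> (x \<in> set C \<and> y \<in> set C)"

definition pendant :: "'a set" where
  "pendant = {x \<in> V - set C. degree V E x \<le> 1 \<and> (\<exists>c\<in>set C. E x c \<and> degree V E c \<ge> 4)} \<union>
     {c \<in> set C. degree V E c \<le> 3 \<and> (\<exists>u. E c u \<and> u \<notin> set C)}"

lemma R_sym: "R x y \<Longrightarrow> R y x"
  unfolding R_def using sym by blast

lemma pendant_unique: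
  assumes "d \<in> pendant" "R d x" "R d y"
  shows "x = y"
proof -
  let ?N = "{w \<in> V. R d w}"
  have "card ?N \<le> 1"
  proof (cases "d \<in> set C")
    case True
    then have "?N = {w \<in> V. E d w \<and> w \<notin> set C}" by (auto simp: R_def)
    moreover obtain u where "E d u" "u \<notin> set C" "degree V E d \<le> 3"
      using assms(1) True by (auto simp: pendant_def)
    ultimately show ?thesis using card_off_spine_neighbours[OF True, of u] by simp
  next
    case False
    then have "degree V E d \<le> 1" using assms by (auto simp: pendant_def)
    moreover have "card ?N \<le> degree V E d"
      unfolding degree_def by (rule card_mono) (use finite_V in \<open>auto simp: R_def\<close>)
    ultimately show ?thesis by simp
  qed
  then show ?thesis using assms edge_V finite_V by (auto simp: card_le_Suc0_iff_eq R_def)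
qed

text \<open>The hub is where a pendant vertex gets attached in the ordering; it must itself have a
  fixed place, and lying in the other class makes one half of strong consistency vacuous. A hub off
  the spine is not pendant because its only spine neighbour is \<open>d\<close>, of degree at most
  3; a hub on the spine has degree at least 4.\<close>

lemma pendant_hub:
  assumes "d \<in> pendant"
  obtains w where "R d w" "w \<in> V - pendant" "w \<in> set C \<longleftrightarrow> d \<notin> set C"
proof (cases "d \<in> set C")
  case True
  then obtain u where u: "E d u" "u \<notin> set C" "degree V E d \<le> 3" using assms by (auto simp: pendant_def)
  have "c = d" if "c \<in> set C" "E u c" for c
    using spine_neighbour_unique[OF u(2) that(1) True that(2) sym[OF u(1)]] .
  then have "u \<notin> pendant" using u unfolding pendant_def by fastforce
  then show thesis using that[of u] True u edge_V by (auto simp: R_def)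
next
  case False
  then obtain c where "c \<in> set C" "E d c" "degree V E c \<ge> 4" using assms by (auto simp: pendant_def)
  then show thesis using that[of c] False edge_V by (auto simp: R_def pendant_def)
qed

text \<open>A spine vertex that is not pendant but has a branch has degree at least 4, so its leaves
  off the spine are pendant and at most two nonleaves remain. Off the spine degrees are at most 3 by
  (a), and at degree 3 the neighbour given by (b) is pendant.\<close>

lemma card_R_neighbours:
  assumes "x \<in> V - pendant"
  shows "card {y \<in> V - pendant. R x y} \<le> 2"
proof (cases "x \<in> set C")
  case True
  have "{y \<in> V - pendant. R x y} \<subseteq> {w \<in> V. E x w \<and> w \<notin> set C \<and> degree V E w > 1}"
  proof
    fix y assume y: "y \<in> {y \<in> V - pendant. R x y}"
    then have "E x y" "y \<notin> set C" using True by (auto simp: R_def)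
    moreover from this have "degree V E x \<ge> 4" using assms True by (force simp: pendant_def)
    ultimately show "y \<in> {w \<in> V. E x w \<and> w \<notin> set C \<and> degree V E w > 1}"
      using y True sym by (force simp: pendant_def)
  qed
  then have "card {y \<in> V - pendant. R x y} \<le> card {w \<in> V. E x w \<and> w \<notin> set C \<and> degree V E w > 1}"
    by (intro card_mono) (use finite_V in auto)
  then show ?thesis using card_off_spine_nonleaves[OF True] by linarith
next
  case False
  have le: "card {y \<in> V - pendant. R x y} \<le> degree V E x"
    unfolding degree_def by (rule card_mono) (use finite_V in \<open>auto simp: R_def\<close>)
  have "degree V E x < 4" using heavy[of x] False assms by (auto simp: not_le[symmetric])
  then consider "degree V E x \<le> 2" | "degree V E x = 3" by linarith
  then show ?thesis
  proof cases
    case 2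
    then obtain w where w: "w \<in> set C" "E x w" "degree V E w \<le> 3"
      using degree_3[of x] False assms by auto
    then have "w \<in> pendant" using False sym by (auto simp: pendant_def)
    then have "card {y \<in> V - pendant. R x y} \<le> card ({y \<in> V. E x y} - {w})"
      by (intro card_mono) (use finite_V in \<open>auto simp: R_def\<close>)
    also have "\<dots> = 2" using 2 w C_subset finite_V by (auto simp: degree_def card_Diff_singleton)
    finally show ?thesis .
  qed (use le in linarith)
qed

text \<open>The least index only serves to choose a value that is constant on the components of
  \<open>R\<close>; each component contains exactly one spine vertex.\<close>

definition block :: "'a \<Rightarrow> nat" where
  "block v = (LEAST i. i < length C \<and> R\<^sup>*\<^sup>* v (C ! i))"

lemma block_cong: "R x y \<Longrightarrow> block x = block y"
  unfolding block_def by (metis R_sym converse_rtranclp_into_rtranclp)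

lemma block_nth:
  assumes "i < length C"
  shows "block (C ! i) = i"
proof -
  have R: "R = (\<lambda>x y. E x y \<and> \<not> (x \<in> set C \<and> y \<in> set C))" by (simp add: R_def fun_eq_iff)
  have symp: "symp R\<^sup>*\<^sup>*" by (rule symp_rtranclp[OF sympI], erule R_sym)
  have "j = i" if "j < length C" "R\<^sup>*\<^sup>* (C ! i) (C ! j)" for j
    using path_vertices_separated[OF path, of i j] path_vertices_separated[OF path, of j i]
      that assms symp R by (metis linorder_neqE_nat sympD)
  then show ?thesis unfolding block_def
    using assms by (intro Least_equality) auto
qed

text \<open>Both classes are ordered block by block along the spine. Within a block the vertices that
  are not pendant induce a path, which is followed from one end to the other, and each pendant
  vertex is inserted immediately before its only neighbour in the block.\<close>

lemma proper_2_thin: "proper_k_thin V E 2"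
proof -
  \<comment> \<open>Outside \<open>pendant\<close> the relation \<open>R\<close> is a linear forest:
    a subgraph of a tree with all degrees at most 2.\<close>
  obtain f :: "'a \<Rightarrow> int" where f_inj: "inj_on f (V - pendant)"
    and f: "\<And>r s t. r \<in> V - pendant \<Longrightarrow> s \<in> V - pendant \<Longrightarrow> t \<in> V - pendant \<Longrightarrow>
      f r < f s \<Longrightarrow> f s < f t \<Longrightarrow> \<not> R r t"
  proof -
    have low: "\<exists>x\<in>U. card {y \<in> U. R x y} \<le> 1" if U: "U \<subseteq> V - pendant" "U \<noteq> {}" for U
    proof -
      obtain x where x: "x \<in> U" "card {y \<in> U. E x y} \<le> 1" using exists_low_degree[of U] U by blast
      have "card {y \<in> U. R x y} \<le> card {y \<in> U. E x y}"
        by (rule card_mono) (use finite_V that in \<open>auto simp: R_def intro: finite_subset\<close>)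
      then show ?thesis using x by (intro bexI[of _ x]) auto
    qed
    have "finite (V - pendant)" "symp R" "\<not> R x x" for x
      using finite_V irrefl R_sym by (auto simp: R_def symp_def)
    then have "\<exists>f :: 'a \<Rightarrow> int. inj_on f (V - pendant) \<and>
      (\<forall>r\<in>V - pendant. \<forall>s\<in>V - pendant. \<forall>t\<in>V - pendant. f r < f s \<longrightarrow> f s < f t \<longrightarrow> \<not> R r t)"
      by (intro linear_forest_ordering low card_R_neighbours)
    then show thesis using that by auto
  qed
  \<comment> \<open>A pendant vertex is sent to its hub; the choice is determined by
    \<open>pendant_unique\<close>.\<close>
  define h where "h = (\<lambda>v. if v \<in> pendant then SOME w. R v w else v)"
  have h_id: "h v = v" if "v \<notin> pendant" for v using that by (simp add: h_def)
  have h: "R d (h d)" "h d \<in> V - pendant" "h d \<in> set C \<longleftrightarrow> d \<notin> set C" if d: "d \<in> pendant" for d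
  proof -
    obtain w where w: "R d w" "w \<in> V - pendant" "w \<in> set C \<longleftrightarrow> d \<notin> set C" using pendant_hub[OF d] .
    then have "R d (h d)" using d by (auto simp: h_def intro: someI)
    moreover from this have "h d = w" using pendant_unique[OF d] w by blast
    ultimately show "R d (h d)" "h d \<in> V - pendant" "h d \<in> set C \<longleftrightarrow> d \<notin> set C" using w by auto
  qed
  have h_V: "h v \<in> V - pendant" if "v \<in> V" for v using h h_id that by (cases "v \<in> pendant") auto
  obtain g :: "'a \<Rightarrow> nat" and n where g: "inj_on g V" "g ` V = {i. i < n}"
    using finite_imp_inj_to_nat_seg[OF finite_V] by blast
  \<comment> \<open>Pendant vertices with the same hub are told apart by \<open>g\<close>; the hub
    gets \<open>n\<close>, larger than all these values, and so follows them.\<close>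
  define tie where "tie = (\<lambda>v. if v \<in> pendant then g v else n)"
  have pendant_V: "pendant \<subseteq> V" using C_subset by (auto simp: pendant_def)
  have tie_le: "tie v \<le> n" "tie v = n \<longleftrightarrow> v \<notin> pendant" for v
  proof -
    have "g v < n" if "v \<in> pendant" using g(2) pendant_V that by blast
    then show "tie v \<le> n" "tie v = n \<longleftrightarrow> v \<notin> pendant" by (auto simp: tie_def)
  qed
  define key where "key = (\<lambda>v. (block v, f (h v), tie v))"
  have "inj_on key V"
  proof (rule inj_onI)
    fix x y assume xy: "x \<in> V" "y \<in> V" "key x = key y"
    then have "h x = h y" "tie x = tie y"
      using f_inj h_V by (auto simp: key_def dest: inj_onD)
    then show "x = y"
      using xy g h_id tie_le[of x] tie_le[of y]
      by (cases "x \<in> pendant"; cases "y \<in> pendant") (auto simp: tie_def dest: inj_onD)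
  qed
  then obtain ord :: "'a \<Rightarrow> nat" where ord: "inj_on ord V"
    and ord_key: "\<And>x y. x \<in> V \<Longrightarrow> y \<in> V \<Longrightarrow> ord x < ord y \<Longrightarrow> key x < key y"
    using exists_nat_rank[OF finite_V] by blast
  define cls :: "'a \<Rightarrow> nat" where "cls = (\<lambda>v. if v \<in> set C then 0 else 1)"
  have cls_eq: "cls u = cls v \<longleftrightarrow> (u \<in> set C \<longleftrightarrow> v \<in> set C)" for u v by (simp add: cls_def)
  have "(cls r = cls s \<longrightarrow> E s t) \<and> (cls s = cls t \<longrightarrow> E r s)"
    if V: "r \<in> V" "s \<in> V" "t \<in> V" and "ord r < ord s" "ord s < ord t" and E: "E r t" for r s t
  proof -
    have lt: "key r < key s" "key s < key t" using ord_key that by blast+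
    then have blocks: "block r \<le> block s" "block s \<le> block t" by (auto simp: key_def)
    show ?thesis
    proof (cases "r \<in> set C \<and> t \<in> set C")
      case True
      \<comment> \<open>A spine edge joins consecutive spine vertices, so \<open>s\<close> is in the
        other class and both implications are vacuous.\<close>
      have "s \<notin> set C"
      proof
        assume "s \<in> set C"
        obtain i j k where ijk: "r = C ! i" "s = C ! j" "t = C ! k" "i < length C" "j < length C" "k < length C"
          using True \<open>s \<in> set C\<close> by (metis in_set_conv_nth)
        then have "i \<le> j" "j \<le> k" using blocks block_nth by auto
        moreover have "i \<noteq> j" "j \<noteq> k" using lt ijk by auto
        ultimately have "i < j" "j < k" by auto
        then show False using path_edge_consecutive[OF path, of i k] ijk E by auto
      qed
      then show ?thesis using True by (auto simp: cls_eq)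
    next
      case False
      then have R: "R r t" using E by (simp add: R_def)
      then have "block r = block t" by (rule block_cong)
      then have le: "(f (h r), tie r) < (f (h s), tie s)" "(f (h s), tie s) < (f (h t), tie t)"
        using lt blocks by (auto simp: key_def)
      \<comment> \<open>A pendant \<open>t\<close> would have \<open>r\<close> as its hub and would
        precede it.\<close>
      have t: "t \<notin> pendant"
      proof
        assume "t \<in> pendant"
        then have "h t = r" using pendant_unique[of t r "h t"] h R R_sym by auto
        moreover have "r \<notin> pendant" using h(2)[OF \<open>t \<in> pendant\<close>] calculation by auto
        ultimately show False using le tie_le[of s] tie_le[of t] tie_le[of r] h_id[of r] by auto
      qed
      \<comment> \<open>If \<open>r\<close> is pendant, its hub is \<open>t\<close>, and the
        position of \<open>h s\<close> is squeezed to that of \<open>t\<close>. Otherwise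
        \<open>h s\<close> lies strictly after \<open>r\<close> and not beyond \<open>t\<close>, and
        \<open>f\<close> leaves nothing strictly between them.\<close>
      have hs: "h s = t"
      proof (cases "r \<in> pendant")
        case True
        then have "h r = t" using pendant_unique[of r t "h r"] h R by auto
        then have "f (h s) = f t" using le h_id[OF t] by auto
        then show ?thesis using f_inj h_V[OF V(2)] t V by (auto dest: inj_onD)
      next
        case r: False
        have "f (h s) \<noteq> f r" using le(1) tie_le[of r] tie_le[of s] h_id[OF r] r by auto
        then have "f r < f (h s)" using le h_id[OF r] by auto
        then have "\<not> f (h s) < f t" using f[of r "h s" t] r t R V h_V[of s] by auto
        then have "f (h s) = f t" using le h_id[OF t] by auto
        then show ?thesis using f_inj h_V[OF V(2)] t V by (auto dest: inj_onD)
      qed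
      have "s \<noteq> t" using lt by auto
      then have s: "s \<in> pendant" using hs h_id by metis
      then have st: "R s t" "t \<in> set C \<longleftrightarrow> s \<notin> set C" using h[OF s] hs by auto
      have "E s t" using st by (simp add: R_def)
      then show ?thesis using st by (auto simp: cls_eq)
    qed
  qed
  then have "strongly_consistent V E ord cls" unfolding strongly_consistent_def by blast
  then show ?thesis unfolding proper_k_thin_def using ord by (intro exI[of _ ord] exI[of _ cls]) (auto simp: cls_def)
qed

end

section \<open>Values of proper thinness and the equivalence\<close>

context tree
begin

lemma spine_imp_proper_2_thin:
  assumes "spine C0"
    and "\<forall>v\<in>V. degree V E v \<ge> 5 \<longrightarrow> card {w \<in> V. E v w \<and> degree V E w > 1} \<le> 4"
  shows "proper_k_thin V E 2"
proof -
  have "is_path V E xs" if "spine xs" for xs using that by (simp add: spine_def)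
  then obtain C where "spine C" "\<And>ys. spine ys \<Longrightarrow> length ys \<le> length C"
    using longest_path[OF finite_V, where P = spine, OF assms(1)] by blast
  then have "longest_spine C" by (simp add: longest_spine_def)
  then interpret longest_spine_tree V E C using assms by unfold_locales auto
  show ?thesis by (rule proper_2_thin)
qed

text \<open>Covers \<open>k = 1\<close> as well as \<open>k = 2\<close>. Casting ranks to integers
  makes their negatives available for picking a last vertex.\<close>

lemma proper_2_thin_imp:
  assumes "proper_k_thin V E k" "k \<le> 2"
  obtains ord cls where "consistent_tree V E ord cls" "\<And>v. v \<in> V \<Longrightarrow> cls v < k"
proof -
  obtain ord cls where *: "inj_on ord V" "\<forall>v\<in>V. cls v < k" "strongly_consistent V E ord cls"
    using assms unfolding proper_k_thin_def by blast
  have "consistent_tree V E (\<lambda>v. int (ord v)) cls"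
  proof unfold_locales
    show "inj_on (\<lambda>v. int (ord v)) V" using *(1) by (auto simp: inj_on_def)
    show "cls v < 2" if "v \<in> V" for v using * assms that by fastforce
  qed (use *(3) edge_V in \<open>unfold strongly_consistent_def, (metis of_nat_less_iff)+\<close>)
  then show thesis using that * by blast
qed

text \<open>In a single class all neighbours share the class, so there are at most two. Conversely
  the tree is a linear forest, and an ordering with no vertex inside an edge is vacuously
  consistent.\<close>

lemma proper_1_thin_iff: "proper_k_thin V E 1 \<longleftrightarrow> (\<forall>v\<in>V. degree V E v \<le> 2)"
proof
  assume "proper_k_thin V E 1"
  then obtain ord cls where *: "consistent_tree V E ord cls" "\<And>v. v \<in> V \<Longrightarrow> cls v < 1"
    by (rule proper_2_thin_imp) auto
  interpret consistent_tree V E ord cls by fact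
  show "\<forall>v\<in>V. degree V E v \<le> 2"
  proof
    fix v assume "v \<in> V"
    then have "{w \<in> V. E v w \<and> cls w = cls v} = {w \<in> V. E v w}" using *(2) by auto
    then show "degree V E v \<le> 2" using card_same_class_neighbours[of v] by (simp add: degree_def)
  qed
next
  assume "\<forall>v\<in>V. degree V E v \<le> 2"
  then obtain f :: "'a \<Rightarrow> int" where f: "inj_on f V"
    "\<And>r s t. r \<in> V \<Longrightarrow> s \<in> V \<Longrightarrow> t \<in> V \<Longrightarrow> f r < f s \<Longrightarrow> f s < f t \<Longrightarrow> \<not> E r t"
    using linear_forest_ordering[of V E] finite_V sym irrefl exists_low_degree
    by (auto simp: degree_def sympI)
  obtain ord :: "'a \<Rightarrow> nat" where ord: "inj_on ord V"
    "\<And>x y. x \<in> V \<Longrightarrow> y \<in> V \<Longrightarrow> ord x < ord y \<Longrightarrow> f x < f y"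
    using exists_nat_rank[OF finite_V f(1)] by blast
  have "strongly_consistent V E ord (\<lambda>_. 0)"
    using f(2) ord(2) unfolding strongly_consistent_def by blast
  then show "proper_k_thin V E 1" unfolding proper_k_thin_def using ord(1) by auto
qed

lemma pthin_eq_2_iff: "pthin V E = 2 \<longleftrightarrow> proper_k_thin V E 2 \<and> \<not> proper_k_thin V E 1"
proof -
  have zero: "\<not> proper_k_thin V E 0" using V_nonempty by (auto simp: proper_k_thin_def)
  show ?thesis
  proof
    assume eq: "pthin V E = 2"
    have "\<exists>k. proper_k_thin V E k"
    proof -
      obtain g :: "'a \<Rightarrow> nat" and n where g: "inj_on g V" "g ` V = {i. i < n}"
        using finite_imp_inj_to_nat_seg[OF finite_V] by blast
      \<comment> \<open>With singleton classes both implications are vacuous. Some \<open>k\<close>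
        must exist for the minimum to be attained.\<close>
      then have "strongly_consistent V E g g" unfolding strongly_consistent_def by auto
      then show ?thesis using g unfolding proper_k_thin_def by blast
    qed
    then have "proper_k_thin V E (pthin V E)" unfolding pthin_def by (rule LeastI_ex)
    moreover have "\<not> proper_k_thin V E 1"
      using eq not_less_Least[of 1 "proper_k_thin V E"] by (auto simp: pthin_def)
    ultimately show "proper_k_thin V E 2 \<and> \<not> proper_k_thin V E 1" using eq by simp
  next
    assume *: "proper_k_thin V E 2 \<and> \<not> proper_k_thin V E 1"
    have "2 \<le> k" if "proper_k_thin V E k" for k
      using that * zero by (cases "k = 0"; cases "k = 1") auto
    then show "pthin V E = 2" unfolding pthin_def using * by (intro Least_equality) auto
  qed
qed

end

theorem theorem1:
  fixes V :: "'a set" and E :: "'a \<Rightarrow> 'a \<Rightarrow> bool"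
  assumes "is_tree V E"
  shows "pthin V E = 2 \<longleftrightarrow>
    (\<exists>v\<in>V. degree V E v \<ge> 3) \<and>
    (\<forall>v\<in>V. degree V E v \<ge> 5 \<longrightarrow> card {w \<in> V. E v w \<and> degree V E w > 1} \<le> 4) \<and>
    (\<exists>C0. is_path V E C0 \<and>
       (\<forall>v\<in>V. degree V E v \<ge> 4 \<longrightarrow> v \<in> set C0) \<and>
       (\<forall>v\<in>V. degree V E v = 3 \<and> v \<notin> set C0 \<longrightarrow>
          (\<exists>w\<in>set C0. E v w \<and> degree V E w \<le> 3)))"
    (is "_ \<longleftrightarrow> ?one \<and> ?two \<and> ?three")
proof -
  interpret tree V E using assms by unfold_locales
  have one: "\<not> proper_k_thin V E 1 \<longleftrightarrow> ?one"
    unfolding proper_1_thin_iff by (auto simp: not_le Suc_le_eq eval_nat_numeral)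
  have "proper_k_thin V E 2 \<longleftrightarrow> ?two \<and> ?three"
  proof
    assume "proper_k_thin V E 2"
    then obtain ord cls where "consistent_tree V E ord cls"
      by (rule proper_2_thin_imp) auto
    then interpret consistent_tree V E ord cls .
    show "?two \<and> ?three" using card_nonleaf_neighbours exists_spine by blast
  next
    assume "?two \<and> ?three"
    then show "proper_k_thin V E 2" using spine_imp_proper_2_thin unfolding spine_def by blast
  qed
  then show ?thesis unfolding pthin_eq_2_iff using one by blast
qed

end
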